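(* Let $0<p\le1$, $q>1$, $\beta>0$, $\epsilon\ge0$, and let $k\ge1$ be an integer. Let $\bm{A}\in\mathbb{R}^{m\times n}$, $\bm{b}\in\mathbb{R}^m$, and let $\bm{x}\in\mathbb{R}^n$, $\bm{x}\ne\bm{0}$, be $k$-sparse with $\|\bm{b}-\bm{A}\bm{x}\|_2\le\epsilon$ and $\frac{\|\bm{x}\|_p}{\|\bm{x}\|_q}\le\beta$. Let $\hat{\bm{x}}$ be a solution (global minimizer) of $$\inf_{\bm{z}\in\mathbb{R}^n\setminus\{\bm{0}\}}\left\{\frac{\|\bm{z}\|_p^p}{\|\bm{z}\|_q^p}\;\middle|\;\|\bm{A}\bm{z}-\bm{b}\|_2\le\epsilon\right\}.$$ Let $z_0$ be the unique zero in $[0,+\infty)$ of $$f_{p,q}(z)=z^q-\beta^pk^{-\frac{q-p}{q}}z^p-\beta^pk^{-\frac{q-p}{q}}-1,$$ and set $\Psi:=\beta^p(1+z_0^p)+k^{\frac{q-p}{q}}$. If $\bm{A}$ satisfies the $2k$-RIP with restricted isometry constant $$\delta_{2k}<\frac{1}{\sqrt{1+k^{\frac{2}{\min(q,2)}-\frac{2q+2-2p}{q}}\Psi^2}},$$ then $$\|\hat{\bm{x}}-\bm{x}\|_2\le\frac{2\epsilon\sqrt{1+\delta_{2k}}\left(1+k^{\frac{1}{\min(q,2)}-\frac{2-p+q}{2q}}\sqrt{\Psi}\right)}{1-\delta_{2k}\sqrt{1+k^{\frac{2}{\min(q,2)}-\frac{2q+2-2p}{q}}\Psi^2}}.$$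
   Context: For $0<r<\infty$, $\|\bm{u}\|_r:=(\sum_i|u_i|^r)^{1/r}$ (a quasi-norm if $r<1$). A vector is $k$-sparse if it has at most $k$ nonzero entries. The restricted isometry constant (RIC) $\delta_s$ of $\bm{A}$ is the smallest number such that $(1-\delta_s)\|\bm{u}\|_2^2\le\|\bm{A}\bm{u}\|_2^2\le(1+\delta_s)\|\bm{u}\|_2^2$ for all $s$-sparse $\bm{u}$; $\bm{A}$ satisfies the $s$-RIP if $\delta_s\in[0,1)$. It is known that $f_{p,q}$ has exactly one zero in $[0,+\infty)$. *)

theory Defs
  imports "HOL-Analysis.Analysis"
begin

definition lp_norm :: "real \<Rightarrow> real ^ 'n \<Rightarrow> real" where
  "lp_norm r u = (\<Sum>i\<in>UNIV. \<bar>u $ i\<bar> powr r) powr (1 / r)"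

definition sparse :: "nat \<Rightarrow> real ^ 'n \<Rightarrow> bool" where
  "sparse s u \<longleftrightarrow> card {i. u $ i \<noteq> 0} \<le> s"

definition ric_bound :: "real ^ 'n ^ 'm \<Rightarrow> nat \<Rightarrow> real \<Rightarrow> bool" where
  "ric_bound A s \<delta> \<longleftrightarrow>
     (\<forall>u. sparse s u \<longrightarrow>
        (1 - \<delta>) * (norm u)\<^sup>2 \<le> (norm (A *v u))\<^sup>2 \<and>
        (norm (A *v u))\<^sup>2 \<le> (1 + \<delta>) * (norm u)\<^sup>2)"

text \<open>For \<open>s = 0\<close> every real is a bound, so there is no least one; for \<open>s > 0\<close> the least
  bound exists, see \<open>RIC_least\<close> below.\<close>

definition RIC :: "real ^ 'n ^ 'm \<Rightarrow> nat \<Rightarrow> real" where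
  "RIC A s = (LEAST \<delta>. ric_bound A s \<delta>)"

definition RIP :: "real ^ 'n ^ 'm \<Rightarrow> nat \<Rightarrow> bool" where
  "RIP A s \<longleftrightarrow> RIC A s \<in> {0..<1}"

definition f_pq :: "real \<Rightarrow> real \<Rightarrow> real \<Rightarrow> nat \<Rightarrow> real \<Rightarrow> real" where
  "f_pq p q \<beta> k z =
     z powr q - \<beta> powr p * real k powr (- ((q - p) / q)) * z powr p
       - \<beta> powr p * real k powr (- ((q - p) / q)) - 1"

definition Psi :: "real \<Rightarrow> real \<Rightarrow> real \<Rightarrow> nat \<Rightarrow> real \<Rightarrow> real" where
  "Psi p q \<beta> k z0 = \<beta> powr p * (1 + z0 powr p) + real k powr ((q - p) / q)"

lemma RIC_least:
  fixes A :: "real ^ 'n ^ 'm"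
  assumes "0 < s"
  shows "ric_bound A s (RIC A s)" "ric_bound A s \<delta> \<Longrightarrow> RIC A s \<le> \<delta>"
proof -
  let ?D = "{\<delta>. ric_bound A s \<delta>}"
  have ne: "(1 + (onorm ((*v) A))\<^sup>2) \<in> ?D"
  proof -
    have "(norm (A *v u))\<^sup>2 \<le> (onorm ((*v) A))\<^sup>2 * (norm u)\<^sup>2" for u
    proof -
      have "norm (A *v u) \<le> onorm ((*v) A) * norm u"
        by (rule onorm) (rule matrix_vector_mul_bounded_linear)
      then have "(norm (A *v u))\<^sup>2 \<le> (onorm ((*v) A) * norm u)\<^sup>2"
        by (rule power_mono) simp
      then show ?thesis by (simp add: power_mult_distrib)
    qed
    moreover have "- ((onorm ((*v) A))\<^sup>2 * (norm u)\<^sup>2) \<le> (norm (A *v u))\<^sup>2" for u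
      by (rule order_trans[of _ 0]) auto
    moreover have "x \<le> y \<Longrightarrow> x \<le> 2 * (norm u)\<^sup>2 + y" for x y and u :: "real ^ 'n"
      using zero_le_power2[of "norm u"] by linarith
    ultimately show ?thesis
      unfolding ric_bound_def by (simp add: distrib_right)
  qed
  have lb: "0 \<le> \<delta>" if "\<delta> \<in> ?D" for \<delta>
  proof -
    let ?u = "axis undefined 1 :: real ^ 'n"
    have "{i. ?u $ i \<noteq> 0} = {undefined}" by (auto simp: axis_def)
    then have "sparse s ?u" using assms by (simp add: sparse_def)
    then have "(1 - \<delta>) * (norm ?u)\<^sup>2 \<le> (1 + \<delta>) * (norm ?u)\<^sup>2"
      using that order_trans unfolding ric_bound_def by blast
    then show ?thesis by (simp add: norm_axis_1)
  qed
  have cl: "closed ?D"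
    unfolding ric_bound_def
    by (intro closed_Collect_all closed_Collect_imp closed_Collect_conj closed_Collect_le
        continuous_intros) simp_all
  have bdd: "bdd_below ?D"
    using lb by (rule bdd_belowI)
  have "Inf ?D \<in> ?D"
    using ne bdd by (intro closed_contains_Inf cl) blast+
  moreover have "Inf ?D \<le> \<delta>" if "ric_bound A s \<delta>" for \<delta>
    using that bdd by (intro cInf_lower) auto
  ultimately have "RIC A s = Inf ?D"
    unfolding RIC_def by (intro Least_equality) auto
  then show "ric_bound A s (RIC A s)" "ric_bound A s \<delta> \<Longrightarrow> RIC A s \<le> \<delta>"
    using \<open>Inf ?D \<in> ?D\<close> \<open>\<And>\<delta>. ric_bound A s \<delta> \<Longrightarrow> Inf ?D \<le> \<delta>\<close> by auto
qed

lemma f_pq_unique_zero: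
  fixes p q \<beta> :: real and k :: nat
  assumes "0 < p" "p \<le> 1" "1 < q" "0 < \<beta>" "1 \<le> k"
  shows "\<exists>!z. 0 \<le> z \<and> f_pq p q \<beta> k z = 0"
proof -
  define c where "c = \<beta> powr p * real k powr (- ((q - p) / q))"
  have c: "0 < c" using assms by (simp add: c_def)
  have f: "f_pq p q \<beta> k z = z powr q - c * z powr p - c - 1" for z
    by (simp add: f_pq_def c_def)
  have f0: "f_pq p q \<beta> k 0 < 0" using c by (simp add: f)
  have fac: "f_pq p q \<beta> k z = z powr p * (z powr (q - p) - c) - c - 1" if "0 < z" for z
    using that by (simp add: f algebra_simps flip: powr_add)
  have inc: "f_pq p q \<beta> k z < f_pq p q \<beta> k w"
    if "0 < z" "z < w" "f_pq p q \<beta> k z = 0" for z w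
  proof -
    have "0 < z powr p * (z powr (q - p) - c)" using that c fac[of z] by simp
    then have "0 < z powr (q - p) - c" using that(1) by (simp add: zero_less_mult_iff)
    moreover have "z powr (q - p) < w powr (q - p)" "z powr p < w powr p"
      using that assms by (auto intro!: powr_less_mono2)
    ultimately have "z powr p * (z powr (q - p) - c) < w powr p * (w powr (q - p) - c)"
      by (intro mult_strict_mono) auto
    then show ?thesis using that fac by simp
  qed
  define M where "M = (2 * c + 1) powr (1 / (q - p)) + 1"
  have M1: "1 \<le> M" by (simp add: M_def)
  have "2 * c + 1 = ((2 * c + 1) powr (1 / (q - p))) powr (q - p)"
    using assms c by (simp add: powr_powr)
  also have "\<dots> \<le> M powr (q - p)"
    using assms by (intro powr_mono2) (auto simp: M_def)
  finally have "c + 1 \<le> M powr (q - p) - c" by simp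
  moreover have "1 \<le> M powr p" using M1 assms by (simp add: ge_one_powr_ge_zero)
  ultimately have "1 * (c + 1) \<le> M powr p * (M powr (q - p) - c)"
    using c by (intro mult_mono) auto
  then have fM: "0 \<le> f_pq p q \<beta> k M" using fac[of M] M1 by simp
  have "continuous_on {0..M} (f_pq p q \<beta> k)"
    unfolding f[abs_def] using assms by (intro continuous_intros continuous_on_powr') auto
  then obtain z where z: "0 \<le> z" "f_pq p q \<beta> k z = 0"
    using IVT'[of "f_pq p q \<beta> k" 0 0 M] f0 fM M1 by auto
  have "w = z" if "0 \<le> w" "f_pq p q \<beta> k w = 0" for w
  proof -
    have "0 < w" "0 < z" using that z f0 by (auto simp: order_le_less)
    then show ?thesis using inc[of w z] inc[of z w] that z by force
  qed
  then show ?thesis using z by blast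
qed

end

theory Submission
  imports Defs
begin

text \<open>Let \<open>h = xhat - x\<close> and let \<open>T\<close> carry the \<open>k\<close> largest entries of \<open>h\<close>. Minimality of \<open>xhat\<close>,
  \<open>p\<close>-subadditivity and Minkowski's inequality give a cone condition for \<open>h\<close>; since the entries off
  \<open>T\<close> are at most \<open>k powr (- 1 / q)\<close> times the \<open>q\<close>-norm of \<open>h\<close> on \<open>T\<close>, the ratio of the \<open>q\<close>-norms of
  \<open>h\<close> off and on \<open>T\<close> is at most \<open>z0\<close>, so \<open>\<Psi>\<close> controls the \<open>p\<close>-norm of the tail. Hence the tail \<open>v\<close> lies
  in the intersection of a box of some radius \<open>\<alpha>\<close> with the \<open>\<ell>\<^sub>1\<close>-ball of radius \<open>k \<alpha>\<close>, whose extreme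
  points are \<open>k\<close>-sparse (the sparse representation of a polytope of Cai and Zhang). For \<open>u\<close> such an
  extreme point and \<open>w\<close> the head of \<open>h\<close>, the restricted isometry property applied to \<open>w\<close> and
  \<open>w + u\<close> bounds \<open>A w \<bullet> A (w + u)\<close> from below, and by convexity the same bound holds for
  \<open>A w \<bullet> A (w + v) = A w \<bullet> A h \<le> \<parallel>A w\<parallel> \<cdot> 2 \<epsilon>\<close>.\<close>

section \<open>Convexity and power-sum inequalities with real exponents\<close>

lemma powr_le_self:
  fixes t r :: real
  assumes "0 \<le> t" "t \<le> 1" "1 \<le> r"
  shows "t powr r \<le> t"
  using assms powr_mono'[of 1 r t] by simp

text \<open>Adds the endpoint 0 to convexity on the open half-line: if one point is 0, the claim
  reduces to \<open>(s * z) powr r \<le> s * z powr r\<close>, which follows from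
  \<open>s powr r \<le> s\<close> on the unit interval.\<close>

lemma convex_on_powr_nonneg:
  fixes r :: real
  assumes "1 \<le> r"
  shows "convex_on {0..} (\<lambda>x. x powr r)"
proof (rule convex_onI)
  fix t x y :: real
  assume t: "0 < t" "t < 1" and xy: "x \<in> {0..}" "y \<in> {0..}"
  have zero: "(s * z) powr r \<le> s * z powr r" if "0 \<le> s" "s \<le> 1" "0 \<le> z" for s z :: real
    using that powr_le_self[OF that(1,2) assms] by (simp add: powr_mult mult_right_mono)
  show "((1 - t) *\<^sub>R x + t *\<^sub>R y) powr r \<le> (1 - t) * x powr r + t * y powr r"
  proof (cases "x = 0 \<or> y = 0")
    case True
    then show ?thesis using zero[of t y] zero[of "1 - t" x] t xy by auto
  next
    case False
    then show ?thesis
      using convex_onD[OF powr_convex[OF assms], of t x y] t xy by auto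
  qed
qed simp

text \<open>Power mean inequality: Jensen for the convex map \<open>t powr (r / s)\<close> at the
  uniform average of the \<open>a i powr s\<close>. Passing from \<open>card S\<close> to
  \<open>k\<close> is monotone because \<open>1 - s / r\<close> is nonnegative.\<close>

lemma sum_powr_mean:
  fixes a :: "'a \<Rightarrow> real"
  assumes "finite S" "card S \<le> k" and a: "\<And>i. i \<in> S \<Longrightarrow> 0 \<le> a i" and "0 < s" "s \<le> r"
  shows "(\<Sum>i\<in>S. a i powr s) \<le> real k powr (1 - s / r) * (\<Sum>i\<in>S. a i powr r) powr (s / r)"
proof (cases "S = {}")
  case False
  define n where "n = real (card S)"
  define m where "m = (\<Sum>i\<in>S. a i powr s)"
  define M where "M = (\<Sum>i\<in>S. a i powr r)"
  have n: "0 < n" using False assms(1) by (simp add: n_def card_gt_0_iff)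
  have nonneg: "0 \<le> m" "0 \<le> M" by (auto simp: m_def M_def sum_nonneg)
  have "(\<Sum>i\<in>S. (1 / n) *\<^sub>R (a i powr s)) powr (r / s) \<le> (\<Sum>i\<in>S. (1 / n) * (a i powr s) powr (r / s))"
    using False assms n
    by (intro convex_on_sum[OF _ _ convex_on_powr_nonneg]) (auto simp: n_def)
  moreover have "(\<Sum>i\<in>S. (1 / n) *\<^sub>R (a i powr s)) = m / n"
    by (simp add: m_def sum_divide_distrib)
  moreover have "(\<Sum>i\<in>S. (1 / n) * (a i powr s) powr (r / s)) = M / n"
    using assms by (simp add: M_def powr_powr sum_divide_distrib)
  ultimately have "(m / n) powr (r / s) \<le> M / n" by simp
  then have "((m / n) powr (r / s)) powr (s / r) \<le> (M / n) powr (s / r)"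
    using assms by (intro powr_mono2) auto
  then have "m / n \<le> (M / n) powr (s / r)"
    using assms n nonneg by (simp add: powr_powr)
  then have "m \<le> n * (M / n) powr (s / r)" using n by (simp add: field_simps)
  also have "\<dots> = n powr (1 - s / r) * M powr (s / r)"
    using n nonneg by (simp add: powr_divide powr_diff)
  also have "\<dots> \<le> real k powr (1 - s / r) * M powr (s / r)"
    using assms n by (intro mult_right_mono powr_mono2) (auto simp: n_def)
  finally show ?thesis by (simp add: m_def M_def)
qed simp

text \<open>Write each term as \<open>b i * b i powr (t - 1)\<close> and bound the second factor by
  the same power of the total.\<close>

lemma sum_powr_superadditive:
  fixes b :: "'a \<Rightarrow> real"
  assumes "finite S" "\<And>i. i \<in> S \<Longrightarrow> 0 \<le> b i" "1 \<le> t"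
  shows "(\<Sum>i\<in>S. b i powr t) \<le> (\<Sum>i\<in>S. b i) powr t"
proof -
  define B where "B = (\<Sum>i\<in>S. b i)"
  have le: "b i \<le> B" if "i \<in> S" for i
    unfolding B_def using assms that by (intro member_le_sum) auto
  have split: "z powr t = z * z powr (t - 1)" if "0 \<le> z" for z :: real
    using powr_mult_base[OF that, of "t - 1"] by simp
  have "(\<Sum>i\<in>S. b i powr t) \<le> (\<Sum>i\<in>S. b i * B powr (t - 1))"
    using assms le by (intro sum_mono) (auto simp: split intro!: mult_left_mono powr_mono2)
  also have "\<dots> = B powr t"
    using assms by (subst split) (auto simp: B_def sum_nonneg sum_distrib_right)
  finally show ?thesis by (simp add: B_def)
qed

text \<open>Superadditivity with exponent \<open>1 / p\<close>, applied to \<open>a powr p\<close>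
  and \<open>b powr p\<close>.\<close>

lemma powr_add_subadditive:
  fixes a b p :: real
  assumes "0 \<le> a" "0 \<le> b" "0 < p" "p \<le> 1"
  shows "(a + b) powr p \<le> a powr p + b powr p"
proof -
  have "(a + b) powr 1 \<le> ((a powr p + b powr p) powr (1 / p))"
    using sum_powr_superadditive[of "{True, False}" "\<lambda>i. if i then a powr p else b powr p" "1 / p"]
      assms by (simp add: powr_powr)
  then have "((a + b) powr 1) powr p \<le> ((a powr p + b powr p) powr (1 / p)) powr p"
    using assms by (intro powr_mono2) auto
  then show ?thesis using assms by (simp add: powr_powr)
qed

text \<open>Minkowski's inequality in homogeneous form: up to the factor
  \<open>\<alpha> + \<gamma>\<close>, the sum \<open>\<bar>a i\<bar> + \<bar>b i\<bar>\<close> is a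
  convex combination of \<open>\<bar>a i\<bar> / \<alpha>\<close> and
  \<open>\<bar>b i\<bar> / \<gamma>\<close>, so convexity of the power applies termwise.\<close>

lemma sum_abs_powr_le:
  fixes a b :: "'a \<Rightarrow> real"
  assumes "finite S" "1 \<le> q" "0 < \<alpha>" "0 < \<gamma>"
    and a: "(\<Sum>i\<in>S. \<bar>a i\<bar> powr q) \<le> \<alpha> powr q" and b: "(\<Sum>i\<in>S. \<bar>b i\<bar> powr q) \<le> \<gamma> powr q"
  shows "(\<Sum>i\<in>S. \<bar>a i + b i\<bar> powr q) \<le> (\<alpha> + \<gamma>) powr q"
proof -
  define t where "t = \<gamma> / (\<alpha> + \<gamma>)"
  have t: "0 < t" "t < 1" "1 - t = \<alpha> / (\<alpha> + \<gamma>)"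
    using assms by (auto simp: t_def field_simps)
  have "\<bar>a i + b i\<bar> powr q \<le>
      (\<alpha> + \<gamma>) powr q * ((1 - t) * (\<bar>a i\<bar> powr q / \<alpha> powr q) + t * (\<bar>b i\<bar> powr q / \<gamma> powr q))" for i
  proof -
    have "(\<alpha> + \<gamma>) * (1 - t) = \<alpha>" "(\<alpha> + \<gamma>) * t = \<gamma>"
      using assms by (simp_all add: t(3)) (simp add: t_def)
    then have "(\<alpha> + \<gamma>) * ((1 - t) * (\<bar>a i\<bar> / \<alpha>) + t * (\<bar>b i\<bar> / \<gamma>)) = \<bar>a i\<bar> + \<bar>b i\<bar>"
      using assms by (simp add: distrib_left flip: mult.assoc)
    then have "\<bar>a i + b i\<bar> \<le> (\<alpha> + \<gamma>) * ((1 - t) * (\<bar>a i\<bar> / \<alpha>) + t * (\<bar>b i\<bar> / \<gamma>))"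
      by simp
    then have "\<bar>a i + b i\<bar> powr q \<le> ((\<alpha> + \<gamma>) * ((1 - t) * (\<bar>a i\<bar> / \<alpha>) + t * (\<bar>b i\<bar> / \<gamma>))) powr q"
      using assms by (intro powr_mono2) auto
    also have "\<dots> = (\<alpha> + \<gamma>) powr q * ((1 - t) * (\<bar>a i\<bar> / \<alpha>) + t * (\<bar>b i\<bar> / \<gamma>)) powr q"
      by (rule powr_mult)
    also have "\<dots> \<le> (\<alpha> + \<gamma>) powr q * ((1 - t) * (\<bar>a i\<bar> / \<alpha>) powr q + t * (\<bar>b i\<bar> / \<gamma>) powr q)"
      using convex_onD[OF convex_on_powr_nonneg[OF assms(2)], of t "\<bar>a i\<bar> / \<alpha>" "\<bar>b i\<bar> / \<gamma>"] assms t
      by (intro mult_left_mono) auto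
    finally show ?thesis using assms by (simp add: powr_divide)
  qed
  then have "(\<Sum>i\<in>S. \<bar>a i + b i\<bar> powr q) \<le>
      (\<Sum>i\<in>S. (\<alpha> + \<gamma>) powr q * ((1 - t) * (\<bar>a i\<bar> powr q / \<alpha> powr q) + t * (\<bar>b i\<bar> powr q / \<gamma> powr q)))"
    by (rule sum_mono)
  also have "\<dots> = (\<alpha> + \<gamma>) powr q *
      ((1 - t) * ((\<Sum>i\<in>S. \<bar>a i\<bar> powr q) / \<alpha> powr q) + t * ((\<Sum>i\<in>S. \<bar>b i\<bar> powr q) / \<gamma> powr q))"
    by (simp only: sum.distrib flip: sum_distrib_left sum_divide_distrib)
  also have "\<dots> \<le> (\<alpha> + \<gamma>) powr q * ((1 - t) * 1 + t * 1)"
    using assms t by (intro mult_left_mono add_mono) auto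
  finally show ?thesis by simp
qed

section \<open>The functional \<open>lp_norm\<close> and restriction to a set of coordinates\<close>

lemma lp_norm_nonneg: "0 \<le> lp_norm r u"
  by (simp add: lp_norm_def)

lemma lp_norm_powr:
  assumes "0 < r"
  shows "lp_norm r u powr r = (\<Sum>i\<in>UNIV. \<bar>u $ i\<bar> powr r)"
  using assms by (simp add: lp_norm_def powr_powr sum_nonneg)

lemma lp_norm_eq_0_iff: "lp_norm r u = 0 \<longleftrightarrow> u = 0"
  by (simp add: lp_norm_def sum_nonneg_eq_0_iff vec_eq_iff)

text \<open>Minkowski with the two norms as radii; zero vectors are separated because the radii must
  be positive.\<close>

lemma lp_norm_triangle:
  assumes "1 \<le> q"
  shows "lp_norm q (u + v) \<le> lp_norm q u + lp_norm q v"
proof (cases "u = 0 \<or> v = 0")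
  case True
  then show ?thesis using lp_norm_nonneg[of q] by auto
next
  case False
  then have pos: "0 < lp_norm q u" "0 < lp_norm q v"
    using lp_norm_nonneg[of q] lp_norm_eq_0_iff[of q] by (auto simp: less_le)
  have "(\<Sum>i\<in>UNIV. \<bar>u $ i + v $ i\<bar> powr q) \<le> (lp_norm q u + lp_norm q v) powr q"
    using assms pos by (intro sum_abs_powr_le) (auto simp: lp_norm_powr)
  then have "lp_norm q (u + v) powr q \<le> (lp_norm q u + lp_norm q v) powr q"
    using assms lp_norm_powr[of q "u + v"] by simp
  then show ?thesis
    using assms pos lp_norm_nonneg[of q] by (smt (verit) powr_less_mono2)
qed

definition vec_restrict :: "'n set \<Rightarrow> real ^ 'n \<Rightarrow> real ^ 'n" where
  "vec_restrict T u = (\<chi> i. if i \<in> T then u $ i else 0)"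

lemma vec_restrict_nth [simp]: "vec_restrict T u $ i = (if i \<in> T then u $ i else 0)"
  by (simp add: vec_restrict_def)

lemma vec_restrict_decomp: "vec_restrict T u + vec_restrict (- T) u = u"
  by (simp add: vec_eq_iff)

lemma lp_norm_vec_restrict_powr:
  assumes "0 < r"
  shows "lp_norm r (vec_restrict T u) powr r = (\<Sum>i\<in>T. \<bar>u $ i\<bar> powr r)"
proof -
  have "(\<Sum>i\<in>UNIV. \<bar>vec_restrict T u $ i\<bar> powr r) = (\<Sum>i\<in>T. \<bar>u $ i\<bar> powr r)"
    by (rule sum.mono_neutral_cong_right) auto
  then show ?thesis using assms by (simp add: lp_norm_powr)
qed

lemma norm_vec_restrict_power2: "(norm (vec_restrict T u))\<^sup>2 = (\<Sum>i\<in>T. \<bar>u $ i\<bar> powr 2)"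
proof -
  have "(norm (vec_restrict T u))\<^sup>2 = (\<Sum>i\<in>UNIV. (vec_restrict T u $ i)\<^sup>2)"
    by (simp add: norm_vec_def L2_set_def sum_nonneg)
  also have "\<dots> = (\<Sum>i\<in>T. (u $ i)\<^sup>2)"
    by (rule sum.mono_neutral_cong_right) auto
  finally show ?thesis by simp
qed

section \<open>Selection of the largest entries\<close>

text \<open>Greedy induction: adjoin to \<open>T\<close> a maximizer of \<open>f\<close> on the
  complement of \<open>T\<close>.\<close>

lemma ex_largest_entries:
  fixes f :: "'a \<Rightarrow> real"
  assumes "finite U" "k \<le> card U"
  shows "\<exists>T\<subseteq>U. card T = k \<and> (\<forall>i\<in>T. \<forall>j\<in>U - T. f j \<le> f i)"
  using assms(2)
proof (induction k)
  case (Suc k)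
  then obtain T where T: "T \<subseteq> U" "card T = k" "\<And>i j. i \<in> T \<Longrightarrow> j \<in> U - T \<Longrightarrow> f j \<le> f i"
    by auto
  have "U - T \<noteq> {}" using Suc.prems T by auto
  moreover have "finite (U - T)" using assms(1) by simp
  ultimately obtain m where m: "m \<in> U - T" "\<And>j. j \<in> U - T \<Longrightarrow> f j \<le> f m"
    using arg_min_if_finite[of "U - T" "\<lambda>i. - f i"] by (meson linorder_not_less neg_less_iff_less)
  have "finite T" using T assms(1) finite_subset by blast
  then show ?case using T m by (intro exI[of _ "insert m T"]) auto
qed (auto intro: exI[of _ "{}"])

text \<open>By cardinality \<open>S - T\<close> injects into \<open>T - S\<close>, and each of its
  terms is dominated by its image; the common part of the two sums cancels.\<close>

lemma sum_le_sum_largest: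
  fixes f :: "'a \<Rightarrow> real"
  assumes "finite S" "finite T" "card S \<le> card T" "\<And>i. 0 \<le> f i"
    and dom: "\<And>i j. i \<in> T \<Longrightarrow> j \<in> S - T \<Longrightarrow> f j \<le> f i"
  shows "sum f S \<le> sum f T"
proof -
  have "card (S - T) \<le> card (T - S)"
    using assms(1-3) by (simp add: card_le_sym_Diff)
  then obtain g where g: "g ` (S - T) \<subseteq> T - S" "inj_on g (S - T)"
    using card_le_inj[of "S - T" "T - S"] assms(1,2) by auto
  have "sum f (S - T) \<le> sum (f \<circ> g) (S - T)"
    using g dom by (intro sum_mono) auto
  also have "\<dots> = sum f (g ` (S - T))" using g by (simp add: sum.reindex)
  also have "\<dots> \<le> sum f (T - S)" using g assms by (intro sum_mono2) auto
  finally have "sum f (S - T) + sum f (S \<inter> T) \<le> sum f (T - S) + sum f (T \<inter> S)"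
    by (simp add: Int_commute)
  then show ?thesis
    using sum.Int_Diff[of S f T] sum.Int_Diff[of T f S] assms by simp
qed

section \<open>Sparse extreme points of a box intersected with an l1-ball\<close>

text \<open>Used with \<open>R = real k * \<alpha>\<close>, where the extreme points become
  \<open>k\<close>-sparse. The support constraint, used for the complement of the head, makes them
  orthogonal to the head.\<close>

definition box_l1_ball :: "real \<Rightarrow> real \<Rightarrow> 'n set \<Rightarrow> (real ^ 'n) set" where
  "box_l1_ball \<alpha> R T =
     {u. (\<forall>i. \<bar>u $ i\<bar> \<le> \<alpha>) \<and> (\<Sum>i\<in>UNIV. \<bar>u $ i\<bar>) \<le> R \<and> (\<forall>i. i \<notin> T \<longrightarrow> u $ i = 0)}"

lemma compact_box_l1_ball: "compact (box_l1_ball \<alpha> R T)"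
proof -
  have "norm u \<le> R" if "u \<in> box_l1_ball \<alpha> R T" for u
    using that norm_le_l1_cart[of u] by (simp add: box_l1_ball_def)
  then have "bounded (box_l1_ball \<alpha> R T)"
    by (auto simp: bounded_iff)
  moreover have "closed (box_l1_ball \<alpha> R T)"
    unfolding box_l1_ball_def
    by (intro closed_Collect_all closed_Collect_imp closed_Collect_conj closed_Collect_le
        closed_Collect_eq continuous_intros) simp_all
  ultimately show ?thesis by (simp add: compact_eq_bounded_closed)
qed

lemma convex_box_l1_ball: "convex (box_l1_ball \<alpha> R T)"
proof (rule convexI)
  fix x y :: "real ^ 'a" and u v :: real
  assume x: "x \<in> box_l1_ball \<alpha> R T" and y: "y \<in> box_l1_ball \<alpha> R T"
    and uv: "0 \<le> u" "0 \<le> v" "u + v = 1"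
  have le: "\<bar>u * x $ i + v * y $ i\<bar> \<le> u * \<bar>x $ i\<bar> + v * \<bar>y $ i\<bar>" for i
    using uv abs_triangle_ineq[of "u * x $ i" "v * y $ i"] by (simp add: abs_mult)
  have "\<bar>u * x $ i + v * y $ i\<bar> \<le> \<alpha>" for i
  proof -
    have "u * \<bar>x $ i\<bar> + v * \<bar>y $ i\<bar> \<le> \<alpha>"
      using x y uv by (intro convex_bound_le) (auto simp: box_l1_ball_def)
    then show ?thesis using le[of i] by simp
  qed
  moreover have "(\<Sum>i\<in>UNIV. \<bar>u * x $ i + v * y $ i\<bar>) \<le> R"
  proof -
    have "(\<Sum>i\<in>UNIV. \<bar>u * x $ i + v * y $ i\<bar>) \<le> (\<Sum>i\<in>UNIV. u * \<bar>x $ i\<bar> + v * \<bar>y $ i\<bar>)"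
      by (intro sum_mono le)
    also have "\<dots> = u * (\<Sum>i\<in>UNIV. \<bar>x $ i\<bar>) + v * (\<Sum>i\<in>UNIV. \<bar>y $ i\<bar>)"
      by (simp add: sum.distrib sum_distrib_left)
    also have "\<dots> \<le> R"
      using x y uv by (intro convex_bound_le) (auto simp: box_l1_ball_def)
    finally show ?thesis .
  qed
  ultimately show "u *\<^sub>R x + v *\<^sub>R y \<in> box_l1_ball \<alpha> R T"
    using x y by (simp add: box_l1_ball_def)
qed

text \<open>If two coordinates were strictly between 0 and \<alpha> in modulus, mass could be moved
  from either one to the other without leaving the set, so \<open>u\<close> would be the midpoint of
  a proper segment.\<close>

lemma extreme_point_box_l1_ball_unique_fractional:
  assumes ext: "u extreme_point_of box_l1_ball \<alpha> R T"
    and i: "0 < \<bar>u $ i\<bar>" "\<bar>u $ i\<bar> < \<alpha>" and j: "0 < \<bar>u $ j\<bar>" "\<bar>u $ j\<bar> < \<alpha>"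
  shows "i = j"
proof (rule ccontr)
  assume ij: "i \<noteq> j"
  have u: "u \<in> box_l1_ball \<alpha> R T" using ext by (simp add: extreme_point_of_def)
  \<comment> \<open>The largest transfer that keeps both moduli between 0 and \<alpha> in either
    direction.\<close>
  define e where "e = Min {\<bar>u $ i\<bar>, \<alpha> - \<bar>u $ i\<bar>, \<bar>u $ j\<bar>, \<alpha> - \<bar>u $ j\<bar>}"
  have "0 < e" using i j by (simp add: e_def)
  have e: "e \<le> \<bar>u $ i\<bar>" "e \<le> \<alpha> - \<bar>u $ i\<bar>" "e \<le> \<bar>u $ j\<bar>" "e \<le> \<alpha> - \<bar>u $ j\<bar>"
    unfolding e_def by (rule Min_le, simp, simp)+
  \<comment> \<open>The signs make \<open>u + d\<close> gain \<open>e\<close> in modulus at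
    \<open>i\<close> and lose \<open>e\<close> at \<open>j\<close>, so the l1-norm is unchanged;
    \<open>u - d\<close> does the reverse.\<close>
  define d :: "real ^ 'a" where
    "d = (\<chi> l. if l = i then e * sgn (u $ i) else if l = j then - e * sgn (u $ j) else 0)"
  have mem: "u + s *\<^sub>R d \<in> box_l1_ball \<alpha> R T" if s: "s = 1 \<or> s = - 1" for s
  proof -
    let ?w = "u + s *\<^sub>R d"
    have wi: "\<bar>?w $ i\<bar> = \<bar>u $ i\<bar> + s * e"
      using s \<open>0 < e\<close> e i by (cases "0 < u $ i") (auto simp: d_def sgn_if)
    have wj: "\<bar>?w $ j\<bar> = \<bar>u $ j\<bar> - s * e"
      using s \<open>0 < e\<close> e j ij by (cases "0 < u $ j") (auto simp: d_def sgn_if)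
    have dl: "d $ l = 0" if "l \<noteq> i" "l \<noteq> j" for l
      using that by (simp add: d_def)
    have "\<bar>?w $ l\<bar> \<le> \<alpha>" for l
    proof -
      consider "l = i" | "l = j" | "l \<noteq> i" "l \<noteq> j" by blast
      then show ?thesis
      proof cases
        case 1
        then show ?thesis using wi s \<open>0 < e\<close> e by auto
      next
        case 2
        then show ?thesis using wj s \<open>0 < e\<close> e by auto
      next
        case 3
        then show ?thesis using dl[OF 3] u unfolding box_l1_ball_def by simp
      qed
    qed
    moreover have "(\<Sum>l\<in>UNIV. \<bar>?w $ l\<bar>) = (\<Sum>l\<in>UNIV. \<bar>u $ l\<bar>)"
    proof -
      have split: "(\<Sum>l\<in>UNIV. f l) = f i + f j + (\<Sum>l\<in>UNIV - {i, j}. f l)" for f :: "'a \<Rightarrow> real"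
        using ij sum.subset_diff[of "{i, j}" UNIV f] by simp
      have "(\<Sum>l\<in>UNIV - {i, j}. \<bar>?w $ l\<bar>) = (\<Sum>l\<in>UNIV - {i, j}. \<bar>u $ l\<bar>)"
        by (rule sum.cong) (use dl in auto)
      then show ?thesis unfolding split wi wj by simp
    qed
    moreover have "?w $ l = 0" if "l \<notin> T" for l
    proof -
      have "u $ l = 0" using u that by (simp add: box_l1_ball_def)
      then have "l \<noteq> i" "l \<noteq> j" using i j by auto
      then show ?thesis using dl[of l] \<open>u $ l = 0\<close> by simp
    qed
    ultimately show ?thesis using u by (simp add: box_l1_ball_def)
  qed
  have "d $ i \<noteq> 0" using \<open>0 < e\<close> i by (simp add: d_def sgn_if)
  have "u + d \<noteq> u - d"
  proof
    assume "u + d = u - d"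
    then have "(u + d) $ i = (u - d) $ i" by (simp only:)
    then show False using \<open>d $ i \<noteq> 0\<close> by simp
  qed
  moreover have "u = midpoint (u + d) (u - d)"
    by (simp add: midpoint_def vec_eq_iff)
  ultimately have "u \<in> open_segment (u + d) (u - d)"
    by (metis midpoint_in_open_segment)
  then show False
    using ext mem[of 1] mem[of "- 1"] by (auto simp: extreme_point_of_def)
qed

text \<open>With more than \<open>k\<close> nonzero entries, all but at most one have modulus
  \<alpha>. At least \<open>k\<close> of these already exhaust the l1-radius, and one further entry
  is still strictly positive.\<close>

lemma extreme_point_box_l1_ball_sparse:
  assumes ext: "u extreme_point_of box_l1_ball \<alpha> (real k * \<alpha>) T" and "0 < \<alpha>"
  shows "sparse k u"
proof (rule ccontr)
  assume "\<not> sparse k u"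
  define P where "P = {i. u $ i \<noteq> 0}"
  define F where "F = {i \<in> P. \<bar>u $ i\<bar> < \<alpha>}"
  have k: "Suc k \<le> card P" using \<open>\<not> sparse k u\<close> by (simp add: sparse_def P_def)
  then have "P \<noteq> {}" by auto
  have u: "u \<in> box_l1_ball \<alpha> (real k * \<alpha>) T" using ext by (simp add: extreme_point_of_def)
  \<comment> \<open>The fractional coordinate if there is one, otherwise any element of the
    support.\<close>
  obtain i where i: "i \<in> P" "F \<subseteq> {i}"
  proof (cases "F = {}")
    case True
    then show ?thesis using that \<open>P \<noteq> {}\<close> by blast
  next
    case False
    then obtain i where "i \<in> F" by blast
    moreover from this have "F \<subseteq> {i}"
      using extreme_point_box_l1_ball_unique_fractional[OF ext] by (auto simp: F_def P_def)
    ultimately show ?thesis using that by (auto simp: F_def)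
  qed
  have "\<alpha> \<le> \<bar>u $ j\<bar>" if "j \<in> P - {i}" for j
    using that i by (force simp: F_def)
  then have "real (card (P - {i})) * \<alpha> \<le> (\<Sum>j\<in>P - {i}. \<bar>u $ j\<bar>)"
    by (rule sum_bounded_below)
  moreover have "real k * \<alpha> \<le> real (card (P - {i})) * \<alpha>"
    using k i assms by (intro mult_right_mono) auto
  moreover have "0 < \<bar>u $ i\<bar>" using i by (simp add: P_def)
  moreover have "(\<Sum>j\<in>P. \<bar>u $ j\<bar>) = \<bar>u $ i\<bar> + (\<Sum>j\<in>P - {i}. \<bar>u $ j\<bar>)"
    using i by (simp add: sum.remove)
  moreover have "(\<Sum>j\<in>P. \<bar>u $ j\<bar>) \<le> (\<Sum>j\<in>UNIV. \<bar>u $ j\<bar>)"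
    by (rule sum_mono2) auto
  moreover have "(\<Sum>j\<in>UNIV. \<bar>u $ j\<bar>) \<le> real k * \<alpha>"
    using u by (simp add: box_l1_ball_def)
  ultimately show False by linarith
qed

lemma norm_le_sqrt_sparse:
  assumes "sparse k u" "\<And>i. \<bar>u $ i\<bar> \<le> \<alpha>"
  shows "norm u \<le> sqrt (real k) * \<alpha>"
proof -
  \<comment> \<open>Any single index suffices here, since an upper bound of an absolute value is
    nonnegative.\<close>
  have \<alpha>: "0 \<le> \<alpha>" using assms(2)[of undefined] abs_ge_zero order_trans by blast
  have "(norm u)\<^sup>2 = (\<Sum>i\<in>UNIV. (u $ i)\<^sup>2)"
    by (simp add: norm_vec_def L2_set_def sum_nonneg)
  also have "\<dots> = (\<Sum>i | u $ i \<noteq> 0. (u $ i)\<^sup>2)"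
    by (rule sum.mono_neutral_right) auto
  also have "\<dots> \<le> real (card {i. u $ i \<noteq> 0}) * \<alpha>\<^sup>2"
    using assms(2) by (intro sum_bounded_above) (metis abs_le_square_iff abs_of_nonneg \<alpha>)
  also have "\<dots> \<le> real k * \<alpha>\<^sup>2"
    using assms(1) by (intro mult_right_mono) (auto simp: sparse_def)
  also have "\<dots> = (sqrt (real k) * \<alpha>)\<^sup>2" by (simp add: power_mult_distrib)
  finally show ?thesis using \<alpha> by (auto intro: power2_le_imp_le)
qed

text \<open>A compact convex set in finite dimension is the hull of its extreme points; these are
  sparse, and sparsity together with the box bounds their Euclidean norm.\<close>

lemma box_l1_ball_subset_hull:
  assumes "0 < \<alpha>"
  shows "box_l1_ball \<alpha> (real k * \<alpha>) T \<subseteq>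
    convex hull {u. sparse k u \<and> (\<forall>i. i \<notin> T \<longrightarrow> u $ i = 0) \<and> norm u \<le> sqrt (real k) * \<alpha>}"
proof -
  let ?K = "box_l1_ball \<alpha> (real k * \<alpha>) T"
  have "?K = convex hull {u. u extreme_point_of ?K}"
    by (rule Krein_Milman_Minkowski[OF compact_box_l1_ball convex_box_l1_ball])
  also have "\<dots> \<subseteq> convex hull
      {u. sparse k u \<and> (\<forall>i. i \<notin> T \<longrightarrow> u $ i = 0) \<and> norm u \<le> sqrt (real k) * \<alpha>}"
  proof (rule hull_mono, safe)
    fix u assume ext: "u extreme_point_of ?K"
    then have u: "u \<in> ?K" by (simp add: extreme_point_of_def)
    show "sparse k u" using ext assms by (rule extreme_point_box_l1_ball_sparse)
    then show "norm u \<le> sqrt (real k) * \<alpha>"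
      using u by (intro norm_le_sqrt_sparse) (auto simp: box_l1_ball_def)
    show "u $ i = 0" if "i \<notin> T" for i using u that by (simp add: box_l1_ball_def)
  qed
  finally show ?thesis .
qed

section \<open>Restricted isometry and inner products of images\<close>

lemma sparse_vanishing:
  assumes "\<And>i. i \<notin> P \<Longrightarrow> u $ i = 0" "card P \<le> s"
  shows "sparse s u"
proof -
  have "card {i. u $ i \<noteq> 0} \<le> card P"
    using assms(1) by (intro card_mono) auto
  then show ?thesis using assms(2) by (simp add: sparse_def)
qed

text \<open>Polarization: the lower isometry bound at \<open>a + c\<close> and the upper one at
  \<open>a - c\<close>, both supported in \<open>P\<close>. Normalizing to unit vectors first gives
  the error \<open>\<delta> * norm u * norm v\<close> rather than one in the mean of the squared
  norms.\<close>

lemma ric_bound_inner: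
  fixes A :: "real ^ 'n ^ 'm"
  assumes ric: "ric_bound A s \<delta>" and P: "card P \<le> s"
    and u: "\<And>i. i \<notin> P \<Longrightarrow> u $ i = 0" and v: "\<And>i. i \<notin> P \<Longrightarrow> v $ i = 0"
  shows "u \<bullet> v - \<delta> * norm u * norm v \<le> (A *v u) \<bullet> (A *v v)"
proof (cases "u = 0 \<or> v = 0")
  case False
  define a where "a = (1 / norm u) *\<^sub>R u"
  define c where "c = (1 / norm v) *\<^sub>R v"
  have nrm: "norm a = 1" "norm c = 1" using False by (simp_all add: a_def c_def)
  have sp: "sparse s (a + c)" "sparse s (a - c)"
    using u v P by (auto intro!: sparse_vanishing[of P] simp: a_def c_def)
  have "(1 - \<delta>) * (norm (a + c))\<^sup>2 \<le> (norm (A *v (a + c)))\<^sup>2"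
    "(norm (A *v (a - c)))\<^sup>2 \<le> (1 + \<delta>) * (norm (a - c))\<^sup>2"
    using ric sp by (auto simp: ric_bound_def)
  moreover have "(norm (a + c))\<^sup>2 = 2 + 2 * (a \<bullet> c)" "(norm (a - c))\<^sup>2 = 2 - 2 * (a \<bullet> c)"
    using nrm by (simp_all add: power2_norm_eq_inner inner_add_left inner_add_right
        inner_diff_left inner_diff_right inner_commute norm_eq_1)
  moreover have "(norm (A *v (a + c)))\<^sup>2 - (norm (A *v (a - c)))\<^sup>2 = 4 * ((A *v a) \<bullet> (A *v c))"
    by (simp add: matrix_vector_right_distrib matrix_vector_mult_diff_distrib power2_norm_eq_inner
        inner_add_left inner_add_right inner_diff_left inner_diff_right inner_commute)
  ultimately have "a \<bullet> c - \<delta> \<le> (A *v a) \<bullet> (A *v c)"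
    by (simp add: algebra_simps)
  then have "norm u * norm v * (a \<bullet> c - \<delta>) \<le> norm u * norm v * ((A *v a) \<bullet> (A *v c))"
    by (intro mult_left_mono) auto
  moreover have "A *v a = (1 / norm u) *\<^sub>R (A *v u)" "A *v c = (1 / norm v) *\<^sub>R (A *v v)"
    by (simp_all add: a_def c_def matrix_vector_mult_scaleR)
  ultimately show ?thesis using False by (simp add: a_def c_def algebra_simps)
qed auto

text \<open>The inner product of the images is affine in the tail, so it suffices to bound it from
  below at the sparse points whose convex hull contains the tail.\<close>

lemma ric_bound_inner_tail:
  fixes A :: "real ^ 'n ^ 'm"
  assumes ric: "ric_bound A (2 * k) \<delta>" and "0 \<le> \<delta>" "0 < \<alpha>" "card T \<le> k" "0 \<le> \<rho>"
    and w: "\<And>i. i \<notin> T \<Longrightarrow> w $ i = 0"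
    and v: "v \<in> box_l1_ball \<alpha> (real k * \<alpha>) (- T)"
    and \<alpha>: "sqrt (real k) * \<alpha> \<le> \<rho> * norm w"
  shows "(norm w)\<^sup>2 * (1 - \<delta> * sqrt (1 + \<rho>\<^sup>2)) \<le> (A *v w) \<bullet> (A *v (w + v))"
proof -
  let ?C = "(norm w)\<^sup>2 * (1 - \<delta> * sqrt (1 + \<rho>\<^sup>2))"
  let ?H = "{u. ?C \<le> (A *v w) \<bullet> (A *v (w + u))}"
  have "convex ?H"
  proof (rule convexI)
    fix x y and a b :: real
    assume "x \<in> ?H" "y \<in> ?H" and ab: "0 \<le> a" "0 \<le> b" "a + b = 1"
    then have "a * ?C + b * ?C \<le> a * ((A *v w) \<bullet> (A *v (w + x))) + b * ((A *v w) \<bullet> (A *v (w + y)))"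
      by (intro add_mono mult_left_mono) auto
    moreover have "a * ?C + b * ?C = ?C" using ab by (simp flip: distrib_right)
    \<comment> \<open>As the weights sum to one, \<open>w\<close> distributes over the convex
      combination.\<close>
    moreover have eq: "w + (a *\<^sub>R x + b *\<^sub>R y) = a *\<^sub>R (w + x) + b *\<^sub>R (w + y)"
    proof -
      have "w = a *\<^sub>R w + b *\<^sub>R w" using ab by (simp flip: scaleR_add_left)
      then show ?thesis by (simp add: scaleR_add_right)
    qed
    ultimately show "a *\<^sub>R x + b *\<^sub>R y \<in> ?H"
      by (simp only: mem_Collect_eq eq matrix_vector_right_distrib[of A "a *\<^sub>R (w + x)"]
          matrix_vector_mult_scaleR inner_add_right inner_scaleR_right)
  qed
  moreover have "u \<in> ?H"
    if u: "sparse k u" "\<forall>i. i \<notin> - T \<longrightarrow> u $ i = 0" "norm u \<le> sqrt (real k) * \<alpha>" for u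
  proof -
    \<comment> \<open>The supports of head and extreme point together have at most
      \<open>2 * k\<close> indices, which is where the order of the isometry constant comes
      from.\<close>
    define P where "P = T \<union> {i. u $ i \<noteq> 0}"
    have P: "card P \<le> 2 * k"
      using card_Un_le[of T "{i. u $ i \<noteq> 0}"] u(1) \<open>card T \<le> k\<close>
      by (simp add: P_def sparse_def)
    \<comment> \<open>Disjoint supports give orthogonality, so Pythagoras produces the factor
      \<open>sqrt (1 + \<rho>\<^sup>2)\<close>.\<close>
    have wu: "w \<bullet> u = 0"
      unfolding inner_vec_def using w u(2) by (intro sum.neutral) fastforce
    have "(norm (w + u))\<^sup>2 = (norm w)\<^sup>2 + (norm u)\<^sup>2"
      using wu by (simp add: power2_norm_eq_inner inner_add_left inner_add_right inner_commute)
    also have "\<dots> \<le> (norm w)\<^sup>2 + (\<rho> * norm w)\<^sup>2"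
      using u(3) \<alpha> by (intro add_left_mono power_mono) auto
    also have "\<dots> = (norm w * sqrt (1 + \<rho>\<^sup>2))\<^sup>2"
      by (simp add: power_mult_distrib algebra_simps)
    finally have "norm (w + u) \<le> norm w * sqrt (1 + \<rho>\<^sup>2)"
      by (rule power2_le_imp_le) simp
    then have "\<delta> * norm w * norm (w + u) \<le> \<delta> * norm w * (norm w * sqrt (1 + \<rho>\<^sup>2))"
      using \<open>0 \<le> \<delta>\<close> by (intro mult_left_mono) auto
    moreover have "w \<bullet> (w + u) - \<delta> * norm w * norm (w + u) \<le> (A *v w) \<bullet> (A *v (w + u))"
      using ric P by (rule ric_bound_inner) (use w in \<open>auto simp: P_def\<close>)
    moreover have "w \<bullet> (w + u) = (norm w)\<^sup>2"
      using wu by (simp add: inner_add_right power2_norm_eq_inner)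
    ultimately show ?thesis by (simp add: algebra_simps power2_eq_square)
  qed
  ultimately have "convex hull {u. sparse k u \<and> (\<forall>i. i \<notin> - T \<longrightarrow> u $ i = 0) \<and>
      norm u \<le> sqrt (real k) * \<alpha>} \<subseteq> ?H"
    by (intro hull_minimal) blast+
  then show ?thesis using box_l1_ball_subset_hull[OF \<open>0 < \<alpha>\<close>, of k "- T"] v by blast
qed

section \<open>Comparison of norms on head and tail\<close>

lemma powr_le_powrD:
  fixes a b q :: real
  assumes "a powr q \<le> b powr q" "0 \<le> b" "0 < q"
  shows "a \<le> b"
  using assms powr_less_mono2[of q b a] by linarith

text \<open>The surplus exponent \<open>s - p\<close> is bounded termwise. Taking \<open>s\<close>
  to be 1, 2 and \<open>q\<close> converts a bound on the \<open>p\<close>-sum of the tail into the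
  other norms.\<close>

lemma sum_powr_le_bounded:
  fixes a :: "'a \<Rightarrow> real"
  assumes "p \<le> s" "\<And>i. i \<in> S \<Longrightarrow> \<bar>a i\<bar> \<le> \<alpha>"
  shows "(\<Sum>i\<in>S. \<bar>a i\<bar> powr s) \<le> \<alpha> powr (s - p) * (\<Sum>i\<in>S. \<bar>a i\<bar> powr p)"
  unfolding sum_distrib_left
proof (rule sum_mono)
  fix i assume "i \<in> S"
  have "\<bar>a i\<bar> powr s = \<bar>a i\<bar> powr (s - p) * \<bar>a i\<bar> powr p"
    by (simp flip: powr_add)
  also have "\<dots> \<le> \<alpha> powr (s - p) * \<bar>a i\<bar> powr p"
    using assms \<open>i \<in> S\<close> by (intro mult_right_mono powr_mono2) auto
  finally show "\<bar>a i\<bar> powr s \<le> \<alpha> powr (s - p) * \<bar>a i\<bar> powr p" .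
qed

text \<open>The minimum merges two regimes: for \<open>q \<ge> 2\<close> the \<open>q\<close>-norm
  is below the Euclidean norm and the exponent of \<open>k\<close> is 0; for \<open>q < 2\<close>
  the power mean inequality on at most \<open>k\<close> entries costs
  \<open>k powr (1 / q - 1 / 2)\<close>.\<close>

lemma lp_norm_restrict_le_norm:
  assumes "0 < q" "1 \<le> k" "card T \<le> k"
  shows "lp_norm q (vec_restrict T u) \<le> real k powr (1 / min q 2 - 1 / 2) * norm (vec_restrict T u)"
proof (rule powr_le_powrD[OF _ _ \<open>0 < q\<close>])
  let ?X = "norm (vec_restrict T u)"
  have X: "(\<Sum>i\<in>T. \<bar>u $ i\<bar> powr 2) = ?X powr 2"
    by (simp only: flip: norm_vec_restrict_power2) simp
  show "lp_norm q (vec_restrict T u) powr q \<le> (real k powr (1 / min q 2 - 1 / 2) * ?X) powr q"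
  proof (cases "2 \<le> q")
    case True
    have "(\<Sum>i\<in>T. \<bar>u $ i\<bar> powr q) = (\<Sum>i\<in>T. (\<bar>u $ i\<bar> powr 2) powr (q / 2))"
      by (simp only: powr_powr) simp
    also have "\<dots> \<le> (\<Sum>i\<in>T. \<bar>u $ i\<bar> powr 2) powr (q / 2)"
      using True by (intro sum_powr_superadditive) auto
    also have "\<dots> = ?X powr q" unfolding X powr_powr by simp
    finally have "(\<Sum>i\<in>T. \<bar>u $ i\<bar> powr q) \<le> ?X powr q" .
    moreover have "1 / min q 2 - 1 / 2 = 0" using True by (simp add: min_def)
    ultimately show ?thesis
      using assms by (simp only: lp_norm_vec_restrict_powr) simp
  next
    case False
    have "(\<Sum>i\<in>T. \<bar>u $ i\<bar> powr q) \<le> real k powr (1 - q / 2) * (\<Sum>i\<in>T. \<bar>u $ i\<bar> powr 2) powr (q / 2)"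
      using assms False by (intro sum_powr_mean) auto
    also have "\<dots> = real k powr ((1 / q - 1 / 2) * q) * ?X powr q"
      using assms unfolding X powr_powr by (simp add: left_diff_distrib)
    finally show ?thesis
      using False assms by (simp add: lp_norm_vec_restrict_powr min_def powr_mult powr_powr)
  qed
qed simp

text \<open>An entry dominated by \<open>k\<close> others has its \<open>q\<close>-th power below
  their average.\<close>

lemma tail_entry_le:
  fixes h :: "real ^ 'n"
  assumes "1 \<le> k" "0 < q" "card T = k \<or> T = UNIV" "j \<notin> T"
    and dom: "\<And>i. i \<in> T \<Longrightarrow> \<bar>h $ j\<bar> \<le> \<bar>h $ i\<bar>"
  shows "\<bar>h $ j\<bar> \<le> real k powr (- 1 / q) * lp_norm q (vec_restrict T h)"
proof (rule powr_le_powrD[OF _ _ \<open>0 < q\<close>])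
  \<comment> \<open>An index outside \<open>T\<close> rules out \<open>T = UNIV\<close>.\<close>
  have "card T = k" using assms by auto
  have "real (card T) * \<bar>h $ j\<bar> powr q \<le> (\<Sum>i\<in>T. \<bar>h $ i\<bar> powr q)"
    using assms by (intro sum_bounded_below powr_mono2) auto
  then have "\<bar>h $ j\<bar> powr q \<le> real k powr (- 1) * lp_norm q (vec_restrict T h) powr q"
    using \<open>card T = k\<close> assms
    by (simp add: lp_norm_vec_restrict_powr powr_minus_divide field_simps)
  then show "\<bar>h $ j\<bar> powr q \<le> (real k powr (- 1 / q) * lp_norm q (vec_restrict T h)) powr q"
    using assms by (simp add: powr_mult powr_powr)
qed (simp add: lp_norm_nonneg)

section \<open>Cone condition and control of the tail by \<open>Psi\<close>\<close>

text \<open>Optimality bounds the \<open>p\<close>-sum of \<open>y\<close> by that of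
  \<open>x\<close> plus an error in \<open>h = y - x\<close>. Splitting along \<open>S\<close>,
  which contains the support of \<open>x\<close>, the contribution of \<open>y\<close> on
  \<open>S\<close> cancels and only \<open>h\<close> remains.\<close>

lemma lp_ratio_minimizer_tail:
  fixes x y :: "real ^ 'n"
  assumes p: "0 < p" "p \<le> 1" and q: "1 \<le> q" and x: "x \<noteq> 0" and y: "y \<noteq> 0"
    and ratio: "lp_norm p y powr p / lp_norm q y powr p \<le> lp_norm p x powr p / lp_norm q x powr p"
    and \<beta>: "lp_norm p x / lp_norm q x \<le> \<beta>"
    and S: "\<And>i. i \<notin> S \<Longrightarrow> x $ i = 0"
  shows "(\<Sum>i\<in>- S. \<bar>(y - x) $ i\<bar> powr p) \<le>
    (\<Sum>i\<in>S. \<bar>(y - x) $ i\<bar> powr p) + \<beta> powr p * lp_norm q (y - x) powr p"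
proof -
  define h where "h = y - x"
  define r where "r = lp_norm p x powr p / lp_norm q x powr p"
  have pos: "0 < lp_norm q x" "0 < lp_norm q y"
    using x y lp_norm_nonneg[of q] lp_norm_eq_0_iff[of q] by (auto simp: less_le)
  have "r = (lp_norm p x / lp_norm q x) powr p"
    by (simp add: r_def powr_divide lp_norm_nonneg)
  also have "\<dots> \<le> \<beta> powr p"
    using \<beta> p lp_norm_nonneg[of p x] lp_norm_nonneg[of q x] by (intro powr_mono2) auto
  finally have r: "r \<le> \<beta> powr p" "0 \<le> r" by (auto simp: r_def)
  have "lp_norm q y \<le> lp_norm q x + lp_norm q h"
    using lp_norm_triangle[OF q, of x h] by (simp add: h_def)
  then have "lp_norm q y powr p \<le> (lp_norm q x + lp_norm q h) powr p"
    using p by (intro powr_mono2) (auto simp: lp_norm_nonneg)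
  also have "\<dots> \<le> lp_norm q x powr p + lp_norm q h powr p"
    using p by (intro powr_add_subadditive) (auto simp: lp_norm_nonneg)
  finally have "r * lp_norm q y powr p \<le> r * (lp_norm q x powr p + lp_norm q h powr p)"
    using r by (intro mult_left_mono)
  \<comment> \<open>The ratio \<open>r\<close> turns the \<open>q\<close>-norm of \<open>x\<close>
    back into its \<open>p\<close>-norm, so \<beta> multiplies only the error term.\<close>
  also have "\<dots> = lp_norm p x powr p + r * lp_norm q h powr p"
    using pos by (simp add: r_def distrib_left)
  also have "\<dots> \<le> lp_norm p x powr p + \<beta> powr p * lp_norm q h powr p"
    using r by (intro add_left_mono mult_right_mono) auto
  finally have "r * lp_norm q y powr p \<le> lp_norm p x powr p + \<beta> powr p * lp_norm q h powr p" .
  moreover have "lp_norm p y powr p \<le> r * lp_norm q y powr p"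
    using ratio pos by (simp add: pos_divide_le_eq flip: r_def)
  ultimately have up: "lp_norm p y powr p \<le> lp_norm p x powr p + \<beta> powr p * lp_norm q h powr p"
    by linarith
  have part: "(\<Sum>i\<in>UNIV. f i) = (\<Sum>i\<in>S. f i) + (\<Sum>i\<in>- S. f i)" for f :: "'n \<Rightarrow> real"
    using sum.subset_diff[of S UNIV f] by (simp add: Compl_eq_Diff_UNIV add.commute)
  have "lp_norm p x powr p = (\<Sum>i\<in>S. \<bar>x $ i\<bar> powr p)"
    unfolding lp_norm_powr[OF p(1)] part using S by simp
  also have "\<dots> \<le> (\<Sum>i\<in>S. \<bar>y $ i\<bar> powr p + \<bar>h $ i\<bar> powr p)"
  proof (rule sum_mono)
    fix i
    have "\<bar>x $ i\<bar> powr p \<le> (\<bar>y $ i\<bar> + \<bar>h $ i\<bar>) powr p"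
      using p by (intro powr_mono2) (auto simp: h_def)
    also have "\<dots> \<le> \<bar>y $ i\<bar> powr p + \<bar>h $ i\<bar> powr p"
      using p by (intro powr_add_subadditive) auto
    finally show "\<bar>x $ i\<bar> powr p \<le> \<bar>y $ i\<bar> powr p + \<bar>h $ i\<bar> powr p" .
  qed
  finally have low: "lp_norm p x powr p \<le> (\<Sum>i\<in>S. \<bar>y $ i\<bar> powr p) + (\<Sum>i\<in>S. \<bar>h $ i\<bar> powr p)"
    by (simp add: sum.distrib)
  \<comment> \<open>Off \<open>S\<close> the vector \<open>x\<close> vanishes, so \<open>y\<close>
    and \<open>h\<close> agree there.\<close>
  have "lp_norm p y powr p = (\<Sum>i\<in>S. \<bar>y $ i\<bar> powr p) + (\<Sum>i\<in>- S. \<bar>h $ i\<bar> powr p)"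
    unfolding lp_norm_powr[OF p(1)] part using S by (simp add: h_def)
  then show ?thesis using up low by (simp flip: h_def)
qed

text \<open>Up to the constant \<open>c + 1\<close>, the function is the product
  \<open>w powr p * (w powr (q - p) - c)\<close>. At the zero \<open>z0\<close> this product equals
  \<open>c + 1 > 0\<close>, so both factors are positive there, and both increase strictly to the
  right.\<close>

lemma f_pq_pos:
  assumes "0 < p" "p < q" "0 \<le> z0" "f_pq p q \<beta> k z0 = 0" "z0 < z"
  shows "0 < f_pq p q \<beta> k z"
proof -
  define c where "c = \<beta> powr p * real k powr (- ((q - p) / q))"
  have c: "0 \<le> c" by (simp add: c_def)
  have fac: "f_pq p q \<beta> k w = w powr p * (w powr (q - p) - c) - c - 1" for w
  proof -
    have "w powr q = w powr p * w powr (q - p)" by (simp flip: powr_add)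
    then show ?thesis by (simp add: f_pq_def c_def algebra_simps)
  qed
  have "0 < z0 powr p * (z0 powr (q - p) - c)" using fac[of z0] assms c by simp
  then have "0 < z0 powr (q - p) - c" by (simp add: zero_less_mult_iff)
  moreover have "z0 powr (q - p) < z powr (q - p)" "z0 powr p < z powr p"
    using assms by (auto intro!: powr_less_mono2)
  ultimately have "z0 powr p * (z0 powr (q - p) - c) < z powr p * (z powr (q - p) - c)"
    by (intro mult_strict_mono) auto
  then show ?thesis using fac[of z0] fac[of z] assms by simp
qed

text \<open>If \<open>z\<close> is the ratio of the \<open>q\<close>-norms of \<open>h\<close> off and on \<open>T\<close>, estimating the \<open>q\<close>-norm of the
  tail by its \<open>p\<close>-norm and the latter by the cone condition yields \<open>f_pq p q \<beta> k z \<le> 0\<close>, hence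
  \<open>z \<le> z0\<close>.\<close>

lemma tail_le_Psi:
  fixes h :: "real ^ 'n"
  assumes p: "0 < p" "p \<le> 1" and q: "1 < q" and k: "1 \<le> k" and T: "card T \<le> k"
    and z0: "0 \<le> z0" "f_pq p q \<beta> k z0 = 0"
    and entry: "\<And>j. j \<notin> T \<Longrightarrow> \<bar>h $ j\<bar> \<le> real k powr (- 1 / q) * lp_norm q (vec_restrict T h)"
    and cone: "(\<Sum>i\<in>- T. \<bar>h $ i\<bar> powr p) \<le> (\<Sum>i\<in>T. \<bar>h $ i\<bar> powr p) + \<beta> powr p * lp_norm q h powr p"
    and N: "0 < lp_norm q (vec_restrict T h)"
  shows "(\<Sum>i\<in>- T. \<bar>h $ i\<bar> powr p) \<le> Psi p q \<beta> k z0 * lp_norm q (vec_restrict T h) powr p"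
proof -
  define N where "N = lp_norm q (vec_restrict T h)"
  define M where "M = lp_norm q (vec_restrict (- T) h)"
  define \<Sigma> where "\<Sigma> = (\<Sum>i\<in>- T. \<bar>h $ i\<bar> powr p)"
  define z where "z = M / N"
  define \<kappa> where "\<kappa> = real k powr ((q - p) / q)"
  have N0: "0 < N" and M0: "0 \<le> M" using N by (simp_all add: N_def M_def lp_norm_nonneg)
  then have z: "0 \<le> z" "M = z * N" by (simp_all add: z_def)
  have \<kappa>: "0 < \<kappa>" "real k powr (- ((q - p) / q)) = 1 / \<kappa>"
    using k by (simp_all add: \<kappa>_def powr_minus_divide)
  \<comment> \<open>The head has at most \<open>k\<close> entries, so the power mean inequality
    costs the factor \<kappa>.\<close>
  have "(\<Sum>i\<in>T. \<bar>h $ i\<bar> powr p) \<le> real k powr (1 - p / q) * (\<Sum>i\<in>T. \<bar>h $ i\<bar> powr q) powr (p / q)"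
    using p q T by (intro sum_powr_mean) auto
  also have "(\<Sum>i\<in>T. \<bar>h $ i\<bar> powr q) powr (p / q) = N powr p"
    using p q by (simp add: N_def powr_powr flip: lp_norm_vec_restrict_powr)
  finally have head: "(\<Sum>i\<in>T. \<bar>h $ i\<bar> powr p) \<le> \<kappa> * N powr p"
    using q by (simp add: \<kappa>_def diff_divide_distrib)
  have "lp_norm q h \<le> N + M"
    using lp_norm_triangle[of q "vec_restrict T h" "vec_restrict (- T) h"] q
    by (simp add: vec_restrict_decomp N_def M_def)
  then have "lp_norm q h powr p \<le> (N + M) powr p"
    using p by (intro powr_mono2) (auto simp: lp_norm_nonneg)
  also have "\<dots> \<le> N powr p + M powr p"
    using p N0 M0 by (intro powr_add_subadditive) auto
  also have "\<dots> = N powr p * (1 + z powr p)"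
    by (simp add: z(2) powr_mult algebra_simps)
  finally have "\<beta> powr p * lp_norm q h powr p \<le> \<beta> powr p * (N powr p * (1 + z powr p))"
    by (intro mult_left_mono) auto
  then have \<Sigma>: "\<Sigma> \<le> N powr p * (\<kappa> + \<beta> powr p * (1 + z powr p))"
    using cone head by (simp add: \<Sigma>_def algebra_simps)
  have "M powr q = (\<Sum>i\<in>- T. \<bar>h $ i\<bar> powr q)"
    using q by (simp add: M_def lp_norm_vec_restrict_powr)
  \<comment> \<open>Here \<open>k powr (- 1 / q)\<close> raised to \<open>q - p\<close> is
    \<open>1 / \<kappa>\<close>; it cancels the \<kappa> of the head and leaves the constant 1 of
    \<open>f_pq\<close>.\<close>
  also have "\<dots> \<le> (real k powr (- 1 / q) * N) powr (q - p) * \<Sigma>"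
    unfolding \<Sigma>_def N_def using p q entry by (intro sum_powr_le_bounded) auto
  also have "\<dots> = N powr (q - p) / \<kappa> * \<Sigma>"
    using \<kappa> by (simp add: powr_mult powr_powr)
  also have "\<dots> \<le> N powr (q - p) / \<kappa> * (N powr p * (\<kappa> + \<beta> powr p * (1 + z powr p)))"
    using \<Sigma> \<kappa> by (intro mult_left_mono) auto
  also have "\<dots> = (N powr (q - p) * N powr p) * (1 + \<beta> powr p / \<kappa> * (1 + z powr p))"
    using \<kappa> by (simp add: field_simps)
  also have "N powr (q - p) * N powr p = N powr q"
    by (simp flip: powr_add)
  finally have "N powr q * z powr q \<le> N powr q * (1 + \<beta> powr p / \<kappa> * (1 + z powr p))"
    by (simp add: z(2) powr_mult mult.commute)
  then have "z powr q \<le> 1 + \<beta> powr p / \<kappa> * (1 + z powr p)"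
    using N0 by simp
  then have "f_pq p q \<beta> k z \<le> 0"
    by (simp add: f_pq_def \<kappa>(2) distrib_left)
  then have "z \<le> z0"
    using f_pq_pos[of p q z0 \<beta> k z] p q z0 by force
  \<comment> \<open>Replacing \<open>z\<close> by \<open>z0\<close> in the bound on \<Sigma> yields
    exactly \<open>Psi\<close>.\<close>
  then have "\<beta> powr p * (1 + z powr p) \<le> \<beta> powr p * (1 + z0 powr p)"
    using p z by (intro mult_left_mono add_left_mono powr_mono2) auto
  then have "N powr p * (\<kappa> + \<beta> powr p * (1 + z powr p)) \<le> N powr p * Psi p q \<beta> k z0"
    by (intro mult_left_mono) (auto simp: Psi_def \<kappa>_def)
  then show ?thesis using \<Sigma> by (simp add: \<Sigma>_def N_def mult.commute)
qed

text \<open>Interpolates the Euclidean norm of the tail between its entry bound and its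
  \<open>p\<close>-sum, then trades the \<open>q\<close>-norm of the head for the Euclidean
  one.\<close>

lemma tail_norm_le:
  fixes h :: "real ^ 'n"
  assumes "p \<le> 1" "0 < q" "1 \<le> k" "card T \<le> k" "0 \<le> \<Psi>"
    and entry: "\<And>j. j \<notin> T \<Longrightarrow> \<bar>h $ j\<bar> \<le> real k powr (- 1 / q) * lp_norm q (vec_restrict T h)"
    and tail: "(\<Sum>i\<in>- T. \<bar>h $ i\<bar> powr p) \<le> \<Psi> * lp_norm q (vec_restrict T h) powr p"
    and N: "0 < lp_norm q (vec_restrict T h)"
  shows "norm (vec_restrict (- T) h) \<le>
    real k powr (1 / min q 2 - (2 - p + q) / (2 * q)) * sqrt \<Psi> * norm (vec_restrict T h)"
proof (rule power2_le_imp_le)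
  define N where "N = lp_norm q (vec_restrict T h)"
  let ?X = "norm (vec_restrict T h)" and ?m = "1 / min q 2 - 1 / 2"
  have N0: "0 < N" using N by (simp add: N_def)
  have "(norm (vec_restrict (- T) h))\<^sup>2 \<le> (real k powr (- 1 / q) * N) powr (2 - p) * (\<Sum>i\<in>- T. \<bar>h $ i\<bar> powr p)"
    unfolding norm_vec_restrict_power2 N_def using assms by (intro sum_powr_le_bounded) auto
  also have "\<dots> \<le> (real k powr (- 1 / q) * N) powr (2 - p) * (\<Psi> * N powr p)"
    using tail by (intro mult_left_mono) (auto simp: N_def)
  also have "\<dots> = real k powr (- ((2 - p) / q)) * \<Psi> * (N powr (2 - p) * N powr p)"
    by (simp add: powr_mult powr_powr)
  also have "N powr (2 - p) * N powr p = N\<^sup>2"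
    using N0 by (simp flip: powr_add)
  also have "real k powr (- ((2 - p) / q)) * \<Psi> * N\<^sup>2 \<le> real k powr (- ((2 - p) / q)) * \<Psi> * (real k powr ?m * ?X)\<^sup>2"
    using lp_norm_restrict_le_norm[of q k T h] assms N0
    by (intro mult_left_mono power_mono) (auto simp: N_def)
  also have "\<dots> = (real k powr (- ((2 - p) / q)) * (real k powr ?m)\<^sup>2) * \<Psi> * ?X\<^sup>2"
    by (simp add: power_mult_distrib)
  also have "real k powr (- ((2 - p) / q)) * (real k powr ?m)\<^sup>2 = (real k powr (1 / min q 2 - (2 - p + q) / (2 * q)))\<^sup>2"
  proof -
    \<comment> \<open>In the final exponent, \<open>(2 - p + q) / (2 * q)\<close> is half of
      \<open>(2 - p) / q\<close> plus the \<open>1 / 2\<close> from the norm comparison.\<close>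
    have "- ((2 - p) / q) + (?m + ?m) =
        (1 / min q 2 - (2 - p + q) / (2 * q)) + (1 / min q 2 - (2 - p + q) / (2 * q))"
      using \<open>0 < q\<close> by (simp add: add_divide_distrib diff_divide_distrib)
    then show ?thesis by (simp only: power2_eq_square flip: powr_add)
  qed
  finally show "(norm (vec_restrict (- T) h))\<^sup>2 \<le>
    (real k powr (1 / min q 2 - (2 - p + q) / (2 * q)) * sqrt \<Psi> * ?X)\<^sup>2"
    using assms by (simp add: power_mult_distrib)
qed (use assms in simp)

text \<open>The radius \<alpha> is chosen so that \<open>real k * \<alpha>\<close> is the l1-bound
  obtained from the \<open>p\<close>-sum of the tail. The box constraint then holds because the
  lower bound on \<Psi> makes \<alpha> at least the entry bound.\<close>

lemma tail_mem_box_l1_ball: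
  fixes h :: "real ^ 'n"
  assumes "p \<le> 1" "0 < q" "1 \<le> k" and \<Psi>: "real k powr ((q - p) / q) \<le> \<Psi>"
    and entry: "\<And>j. j \<notin> T \<Longrightarrow> \<bar>h $ j\<bar> \<le> real k powr (- 1 / q) * lp_norm q (vec_restrict T h)"
    and tail: "(\<Sum>i\<in>- T. \<bar>h $ i\<bar> powr p) \<le> \<Psi> * lp_norm q (vec_restrict T h) powr p"
    and N: "0 < lp_norm q (vec_restrict T h)"
    and \<alpha>: "\<alpha> = real k powr (- (q + 1 - p) / q) * \<Psi> * lp_norm q (vec_restrict T h)"
  shows "vec_restrict (- T) h \<in> box_l1_ball \<alpha> (real k * \<alpha>) (- T)"
proof -
  define N where "N = lp_norm q (vec_restrict T h)"
  have N0: "0 < N" using N by (simp add: N_def)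
  have "- (q + 1 - p) / q + (q - p) / q = - 1 / q"
    using \<open>0 < q\<close> by (simp add: field_simps)
  then have "real k powr (- 1 / q) * N = real k powr (- (q + 1 - p) / q) * real k powr ((q - p) / q) * N"
    by (simp flip: powr_add)
  also have "\<dots> \<le> \<alpha>"
    unfolding \<alpha> N_def using \<Psi> N by (intro mult_right_mono mult_left_mono) auto
  finally have le\<alpha>: "real k powr (- 1 / q) * N \<le> \<alpha>" .
  have \<alpha>0: "0 \<le> \<alpha>"
    using le\<alpha> N0 by (meson mult_nonneg_nonneg order_trans less_imp_le powr_ge_zero)
  have "\<bar>vec_restrict (- T) h $ j\<bar> \<le> \<alpha>" for j
    using entry[of j] le\<alpha> \<alpha>0 by (auto simp: N_def)
  moreover have "(\<Sum>i\<in>UNIV. \<bar>vec_restrict (- T) h $ i\<bar>) \<le> real k * \<alpha>"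
  proof -
    have "(\<Sum>i\<in>UNIV. \<bar>vec_restrict (- T) h $ i\<bar>) = (\<Sum>i\<in>- T. \<bar>h $ i\<bar> powr 1)"
      by (rule sum.mono_neutral_cong_right) auto
    also have "\<dots> \<le> (real k powr (- 1 / q) * N) powr (1 - p) * (\<Sum>i\<in>- T. \<bar>h $ i\<bar> powr p)"
      unfolding N_def using assms by (intro sum_powr_le_bounded) auto
    also have "\<dots> \<le> (real k powr (- 1 / q) * N) powr (1 - p) * (\<Psi> * N powr p)"
      using tail by (intro mult_left_mono) (auto simp: N_def)
    also have "\<dots> = real k powr (- ((1 - p) / q)) * \<Psi> * (N powr (1 - p) * N powr p)"
      by (simp add: powr_mult powr_powr)
    also have "N powr (1 - p) * N powr p = N"
      using N0 by (simp flip: powr_add)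
    also have "real k powr (- ((1 - p) / q)) = real k * real k powr (- (q + 1 - p) / q)"
    proof -
      have "- ((1 - p) / q) = 1 + - (q + 1 - p) / q"
        using \<open>0 < q\<close> by (simp add: field_simps)
      then have "real k powr (- ((1 - p) / q)) = real k powr 1 * real k powr (- (q + 1 - p) / q)"
        by (simp only: powr_add)
      then show ?thesis using \<open>1 \<le> k\<close> by simp
    qed
    finally show ?thesis by (simp add: \<alpha> N_def mult.assoc)
  qed
  ultimately show ?thesis by (simp add: box_l1_ball_def)
qed

section \<open>The error bound, assembled from head and tail estimates\<close>

theorem theorem5p3:
  fixes p q \<beta> \<epsilon> z0 :: real and k :: nat
    and A :: "real ^ 'n ^ 'm" and b :: "real ^ 'm" and x xhat :: "real ^ 'n"
  assumes "0 < p" "p \<le> 1" "1 < q" "0 < \<beta>" "0 \<le> \<epsilon>" "1 \<le> k"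
    and "x \<noteq> 0" "sparse k x" "norm (b - A *v x) \<le> \<epsilon>"
    and "lp_norm p x / lp_norm q x \<le> \<beta>"
    and "is_arg_min (\<lambda>z. lp_norm p z powr p / lp_norm q z powr p)
           (\<lambda>z. z \<noteq> 0 \<and> norm (A *v z - b) \<le> \<epsilon>) xhat"
    and "0 \<le> z0" "f_pq p q \<beta> k z0 = 0"
    and "RIP A (2 * k)"
    and "RIC A (2 * k) <
           1 / sqrt (1 + real k powr (2 / min q 2 - (2 * q + 2 - 2 * p) / q) * (Psi p q \<beta> k z0)\<^sup>2)"
  shows "norm (xhat - x) \<le>
      2 * \<epsilon> * sqrt (1 + RIC A (2 * k)) *
        (1 + real k powr (1 / min q 2 - (2 - p + q) / (2 * q)) * sqrt (Psi p q \<beta> k z0))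
      / (1 - RIC A (2 * k) *
           sqrt (1 + real k powr (2 / min q 2 - (2 * q + 2 - 2 * p) / q) * (Psi p q \<beta> k z0)\<^sup>2))"
proof -
  define h where "h = xhat - x"
  define \<delta> where "\<delta> = RIC A (2 * k)"
  define \<Psi> where "\<Psi> = Psi p q \<beta> k z0"
  \<comment> \<open>Relative to the Euclidean norm of the head, \<rho> will bound the sparse extreme
    points and \<tau> the tail itself.\<close>
  define \<rho> where "\<rho> = real k powr (1 / min q 2 - (q + 1 - p) / q) * \<Psi>"
  define \<tau> where "\<tau> = real k powr (1 / min q 2 - (2 - p + q) / (2 * q)) * sqrt \<Psi>"
  have \<Psi>: "real k powr ((q - p) / q) \<le> \<Psi>" "0 < \<Psi>"
    using assms by (auto simp: \<Psi>_def Psi_def intro!: add_nonneg_pos)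
  have exp: "2 / min q 2 - (2 * q + 2 - 2 * p) / q =
      (1 / min q 2 - (q + 1 - p) / q) + (1 / min q 2 - (q + 1 - p) / q)"
    by (simp add: add_divide_distrib diff_divide_distrib)
  have \<rho>: "\<rho>\<^sup>2 = real k powr (2 / min q 2 - (2 * q + 2 - 2 * p) / q) * (Psi p q \<beta> k z0)\<^sup>2"
    unfolding exp powr_add \<rho>_def \<Psi>_def by (simp add: power2_eq_square)
  have \<rho>0: "0 \<le> \<rho>"
    using \<Psi>(2) by (simp add: \<rho>_def)
  \<comment> \<open>The denominator of the claim; its positivity restates the bound on the isometry
    constant.\<close>
  define D where "D = 1 - \<delta> * sqrt (1 + \<rho>\<^sup>2)"
  have "0 < sqrt (1 + \<rho>\<^sup>2)" by (simp add: add_pos_nonneg)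
  then have D: "0 < D"
    using assms(15) by (simp add: D_def \<delta>_def \<rho> field_simps)
  have \<delta>: "0 \<le> \<delta>" using assms(14) by (simp add: RIP_def \<delta>_def)
  have ric: "ric_bound A (2 * k) \<delta>"
    unfolding \<delta>_def using assms(6) by (intro RIC_least) simp
  have \<tau>: "0 \<le> \<tau>" using \<Psi> by (simp add: \<tau>_def)
  have goal: "norm h \<le> 2 * \<epsilon> * sqrt (1 + \<delta>) * (1 + \<tau>) / D"
  proof -
    \<comment> \<open>The minimum covers a \<open>k\<close> above the dimension, where
      \<open>T\<close> is the whole index set.\<close>
    obtain T :: "'n set" where T: "card T = min k (card (UNIV :: 'n set))"
      and dom: "\<And>i j. i \<in> T \<Longrightarrow> j \<notin> T \<Longrightarrow> \<bar>h $ j\<bar> \<le> \<bar>h $ i\<bar>"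
      using ex_largest_entries[of "UNIV :: 'n set" "min k (card (UNIV :: 'n set))" "\<lambda>i. \<bar>h $ i\<bar>"]
      by auto
    define N where "N = lp_norm q (vec_restrict T h)"
    define X where "X = norm (vec_restrict T h)"
    have Tk: "card T \<le> k" using T by simp
    have "card T = k \<or> T = UNIV"
      using T card_subset_eq[of "UNIV :: 'n set" T] by (auto simp: min_def split: if_splits)
    then have entry: "\<bar>h $ j\<bar> \<le> real k powr (- 1 / q) * N" if "j \<notin> T" for j
      unfolding N_def using assms that dom by (intro tail_entry_le) auto
    define S where "S = {i. x $ i \<noteq> 0}"
    have S: "card S \<le> card T"
      using assms(8) T by (auto simp: S_def sparse_def intro: card_mono)
    \<comment> \<open>The vector \<open>x\<close> is feasible too, so minimality compares the two
      ratios.\<close>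
    have xhat: "xhat \<noteq> 0" "norm (A *v xhat - b) \<le> \<epsilon>"
      "lp_norm p xhat powr p / lp_norm q xhat powr p \<le> lp_norm p x powr p / lp_norm q x powr p"
      using assms(7,9,11) by (auto simp: is_arg_min_def norm_minus_commute not_less)
    have "(\<Sum>i\<in>- S. \<bar>h $ i\<bar> powr p) \<le> (\<Sum>i\<in>S. \<bar>h $ i\<bar> powr p) + \<beta> powr p * lp_norm q h powr p"
      unfolding h_def using assms xhat by (intro lp_ratio_minimizer_tail) (auto simp: S_def)
    \<comment> \<open>Moving from \<open>S\<close> to \<open>T\<close> enlarges the head sum; as the
      total is fixed, the tail sum shrinks and the cone condition carries over to
      \<open>T\<close>.\<close>
    moreover have head: "(\<Sum>i\<in>S. \<bar>h $ i\<bar> powr p) \<le> (\<Sum>i\<in>T. \<bar>h $ i\<bar> powr p)"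
      using S dom assms(1) by (intro sum_le_sum_largest) (auto intro!: powr_mono2)
    moreover have "(\<Sum>i\<in>R. \<bar>h $ i\<bar> powr p) + (\<Sum>i\<in>- R. \<bar>h $ i\<bar> powr p) = (\<Sum>i\<in>UNIV. \<bar>h $ i\<bar> powr p)" for R
      using sum.subset_diff[of R UNIV "\<lambda>i. \<bar>h $ i\<bar> powr p"] by (simp add: Compl_eq_Diff_UNIV add.commute)
    from this[of S] this[of T] have "(\<Sum>i\<in>S. \<bar>h $ i\<bar> powr p) + (\<Sum>i\<in>- S. \<bar>h $ i\<bar> powr p) =
        (\<Sum>i\<in>T. \<bar>h $ i\<bar> powr p) + (\<Sum>i\<in>- T. \<bar>h $ i\<bar> powr p)"
      by simp
    ultimately have cone: "(\<Sum>i\<in>- T. \<bar>h $ i\<bar> powr p) \<le> (\<Sum>i\<in>T. \<bar>h $ i\<bar> powr p) + \<beta> powr p * lp_norm q h powr p"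
      by linarith
    show ?thesis
    proof (cases "N = 0")
      \<comment> \<open>A vanishing head forces the dominated tail to vanish, so
        \<open>h = 0\<close>.\<close>
      case True
      then have "vec_restrict T h = 0" by (simp add: N_def lp_norm_eq_0_iff)
      then have "h $ i = 0" if "i \<in> T" for i using that by (metis vec_restrict_nth zero_index)
      moreover have "h $ i = 0" if "i \<notin> T" for i using entry[OF that] True by simp
      ultimately have "h = 0" by (auto simp: vec_eq_iff)
      then show ?thesis using D \<tau> \<delta> assms(5) by simp
    next
      case False
      then have N: "0 < N" using lp_norm_nonneg[of q "vec_restrict T h"] by (simp add: N_def less_le)
      then have X: "0 < X" by (auto simp: N_def X_def lp_norm_eq_0_iff[of q] less_le)
      have tail: "(\<Sum>i\<in>- T. \<bar>h $ i\<bar> powr p) \<le> \<Psi> * N powr p"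
        unfolding \<Psi>_def N_def using assms Tk entry cone N by (intro tail_le_Psi) (auto simp: N_def)
      define \<alpha> where "\<alpha> = real k powr (- (q + 1 - p) / q) * \<Psi> * N"
      have \<alpha>: "0 < \<alpha>" using \<Psi> N assms(6) by (simp add: \<alpha>_def)
      have box: "vec_restrict (- T) h \<in> box_l1_ball \<alpha> (real k * \<alpha>) (- T)"
        using assms(1-6) \<Psi>(1) entry tail N
        by (intro tail_mem_box_l1_ball[where p = p and q = q and \<Psi> = \<Psi>]) (auto simp: N_def \<alpha>_def)
      \<comment> \<open>The exponent \<open>1 / 2\<close> of \<open>sqrt (real k)\<close> cancels
        the \<open>- 1 / 2\<close> from the norm comparison on the head.\<close>
      have "sqrt (real k) * \<alpha> \<le> \<rho> * X"
      proof -
        have "sqrt (real k) * \<alpha> = real k powr (1 / 2 + - (q + 1 - p) / q) * \<Psi> * N"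
          by (simp add: \<alpha>_def powr_add powr_half_sqrt)
        also have "\<dots> \<le> real k powr (1 / 2 + - (q + 1 - p) / q) * \<Psi> * (real k powr (1 / min q 2 - 1 / 2) * X)"
          unfolding N_def X_def using \<Psi> assms Tk by (intro mult_left_mono lp_norm_restrict_le_norm) auto
        also have "\<dots> = real k powr ((1 / 2 + - (q + 1 - p) / q) + (1 / min q 2 - 1 / 2)) * \<Psi> * X"
          by (simp only: powr_add mult_ac)
        also have "(1 / 2 + - (q + 1 - p) / q) + (1 / min q 2 - 1 / 2) = 1 / min q 2 - (q + 1 - p) / q"
          by (simp add: diff_divide_distrib add_divide_distrib)
        finally show ?thesis by (simp add: \<rho>_def)
      qed
      then have "X\<^sup>2 * D \<le> (A *v vec_restrict T h) \<bullet> (A *v (vec_restrict T h + vec_restrict (- T) h))"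
        unfolding X_def D_def using ric \<delta> \<alpha> Tk \<rho>0 box
        by (intro ric_bound_inner_tail[where k = k and \<alpha> = \<alpha> and T = T]) auto
      also have "\<dots> = (A *v vec_restrict T h) \<bullet> (A *v h)" by (simp add: vec_restrict_decomp)
      also have "\<dots> \<le> norm (A *v vec_restrict T h) * norm (A *v h)" by (rule norm_cauchy_schwarz)
      also have "\<dots> \<le> (sqrt (1 + \<delta>) * X) * (2 * \<epsilon>)"
      proof (rule mult_mono)
        have "sparse (2 * k) (vec_restrict T h)"
          using Tk by (intro sparse_vanishing[of T]) auto
        then have "(norm (A *v vec_restrict T h))\<^sup>2 \<le> (sqrt (1 + \<delta>) * X)\<^sup>2"
          using ric \<delta> by (simp add: ric_bound_def X_def power_mult_distrib)
        then show "norm (A *v vec_restrict T h) \<le> sqrt (1 + \<delta>) * X"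
          by (rule power2_le_imp_le) (use \<delta> X in simp)
        \<comment> \<open>A difference of two residuals, each at most \<epsilon>.\<close>
        have "A *v h = (A *v xhat - b) + (b - A *v x)"
          by (simp add: h_def matrix_vector_mult_diff_distrib)
        then show "norm (A *v h) \<le> 2 * \<epsilon>"
          using norm_triangle_ineq[of "A *v xhat - b" "b - A *v x"] xhat(2) assms(9) by simp
      qed (use \<delta> X in auto)
      \<comment> \<open>Cancelling one positive factor \<open>X\<close> bounds the head linearly in
        \<epsilon>.\<close>
      finally have "X * (X * D) \<le> X * (2 * \<epsilon> * sqrt (1 + \<delta>))"
        by (simp add: power2_eq_square mult_ac)
      then have XD: "X \<le> 2 * \<epsilon> * sqrt (1 + \<delta>) / D"
        using X D by (simp add: field_simps)
      have "norm h \<le> X + norm (vec_restrict (- T) h)"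
        using norm_triangle_ineq[of "vec_restrict T h" "vec_restrict (- T) h"]
        by (simp add: X_def vec_restrict_decomp)
      also have "norm (vec_restrict (- T) h) \<le> \<tau> * X"
        unfolding \<tau>_def X_def using assms(2,3,6) Tk \<Psi> entry tail N
        by (intro tail_norm_le) (auto simp: N_def)
      also have "X + \<tau> * X = X * (1 + \<tau>)" by (simp add: algebra_simps)
      also have "\<dots> \<le> 2 * \<epsilon> * sqrt (1 + \<delta>) / D * (1 + \<tau>)"
        using XD \<tau> by (intro mult_right_mono) auto
      finally show ?thesis by simp
    qed
  qed
  then show ?thesis
    unfolding D_def \<rho> by (simp only: h_def \<delta>_def \<tau>_def \<Psi>_def)
qed

end
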